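(* Assume that $0<\lambda<\mu^*$, where $\mu^*=B\log_2\bigl(1+\frac{1}{1+\xi_N}\bigr)$. Let $(P_t)_{t\ge0}$ be the transition semigroup of the Markov chain $Q$ of interference-coupled queues with arrival rate $\lambda$, and let $\pi_\lambda$ be its unique invariant distribution. Then for every initial state $x\in\mathbb N^N$ there exist constants $C_x<\infty$ and $\kappa>0$ such that $$\|\delta_xP_t-\pi_\lambda\|_{TV}\le C_xe^{-\kappa t},\qquad t\ge0.$$
   Context: $\mathbb N=\{0,1,2,\dots\}$. Fix an integer $N\ge 2$ and a constant $B>0$. There are $N$ queues indexed by $1,\dots,N$, equally spaced on a discrete torus; $d(i,j)=\min(|i-j|,N-|i-j|)$ is the circular distance. The path-loss function $l$ is one of $\ell_1(r)=(A\max(r,r_0))^{-C}$, $\ell_2(r)=(1+Ar)^{-C}$, $\ell_3(r)=Ae^{-Cr}$, with $A,C,r_0>0$. Put $\xi_N=\sum_{j\ne i} l(d(i,j))$ (independent of $i$). For $q\in\mathbb N^N$ let $\mu_i(q)=B\log_2\Bigl(1+\frac{1}{1+\sum_{j\neq i}\mathbf 1_{\{q_j>0\}}\,l(d(i,j))}\Bigr)$. $Q$ is the (non-explosive, irreducible) continuous-time Markov chain on $\mathbb N^N$ with generator, for bounded $f$, $$\mathcal L f(q)=\lambda\sum_{i=1}^N\bigl(f(q+e_i)-f(q)\bigr)-\sum_{i=1}^N\mu_i(q)\bigl(f(q)-f(q-e_i)\bigr)\mathbf 1_{\{q_i>0\}},$$ where $e_i$ is the $i$-th unit vector. For $\lambda<\mu^*$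 it is positive recurrent, with a unique invariant distribution. $\|\cdot\|_{TV}$ is the total variation norm. *)

theory Defs
  imports "HOL-Probability.Probability"
begin

definition circ_dist :: "nat \<Rightarrow> nat \<Rightarrow> nat \<Rightarrow> real" where
  "circ_dist N i j = min \<bar>real i - real j\<bar> (real N - \<bar>real i - real j\<bar>)"

definition path_loss :: "(real \<Rightarrow> real) \<Rightarrow> bool" where
  "path_loss l \<longleftrightarrow> (\<exists>A C r0. A > 0 \<and> C > 0 \<and> r0 > 0 \<and>
     (l = (\<lambda>r. (A * max r r0) powr (- C)) \<or>
      l = (\<lambda>r. (1 + A * r) powr (- C)) \<or>
      l = (\<lambda>r. A * exp (- C * r))))"

text \<open>The total interference is the same at every queue, see \<open>total_interference_eq\<close>;
  queue 1 is taken as the reference.\<close>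
definition total_interference :: "nat \<Rightarrow> (real \<Rightarrow> real) \<Rightarrow> real" where
  "total_interference N l = (\<Sum>j\<in>{1..N} - {1}. l (circ_dist N 1 j))"

lemma total_interference_eq:
  assumes "i \<in> {1..N}"
  shows "(\<Sum>j\<in>{1..N} - {i}. l (circ_dist N i j)) = total_interference N l"
  unfolding total_interference_def
  by (rule sum.reindex_bij_witness[where
        j = "\<lambda>j. if j \<ge> i then j - i + 1 else j + N - i + 1" and
        i = "\<lambda>k. if k + i - 1 \<le> N then k + i - 1 else k + i - 1 - N"])
     (use assms in \<open>auto simp: circ_dist_def of_nat_diff min_def intro!: arg_cong[where f = l]\<close>)

definition critical_rate :: "nat \<Rightarrow> real \<Rightarrow> (real \<Rightarrow> real) \<Rightarrow> real" where
  "critical_rate N B l = B * log 2 (1 + 1 / (1 + total_interference N l))"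

text \<open>A state in \<open>\<nat>\<^sup>N\<close> is a function on \<open>nat\<close> that vanishes outside the index set
  \<open>{1..N}\<close>.\<close>
definition queue_states :: "nat \<Rightarrow> (nat \<Rightarrow> nat) set" where
  "queue_states N = {q. \<forall>i. i \<notin> {1..N} \<longrightarrow> q i = 0}"

definition service_rate :: "nat \<Rightarrow> real \<Rightarrow> (real \<Rightarrow> real) \<Rightarrow> nat \<Rightarrow> (nat \<Rightarrow> nat) \<Rightarrow> real" where
  "service_rate N B l i q =
     B * log 2 (1 + 1 / (1 + (\<Sum>j\<in>{1..N} - {i}. of_bool (q j > 0) * l (circ_dist N i j))))"

definition queue_generator ::
  "nat \<Rightarrow> real \<Rightarrow> (real \<Rightarrow> real) \<Rightarrow> real \<Rightarrow> ((nat \<Rightarrow> nat) \<Rightarrow> real) \<Rightarrow> (nat \<Rightarrow> nat) \<Rightarrow> real" where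
  "queue_generator N B l lam f q =
     lam * (\<Sum>i\<in>{1..N}. (f (q(i := q i + 1)) - f q))
     - (\<Sum>i\<in>{1..N}. service_rate N B l i q * (f q - f (q(i := q i - 1))) * of_bool (q i > 0))"

text \<open>Transition semigroups on a countable state space \<open>S\<close>: \<open>P t x\<close> is the law at time \<open>t\<close>
  of the chain started in \<open>x\<close>. Its being a probability distribution on \<open>S\<close> expresses
  non-explosion. Nothing is required for \<open>t < 0\<close> or outside \<open>S\<close>.\<close>
definition markov_semigroup_on :: "'a set \<Rightarrow> (real \<Rightarrow> 'a \<Rightarrow> 'a pmf) \<Rightarrow> bool" where
  "markov_semigroup_on S P \<longleftrightarrow>
     (\<forall>t\<ge>0. \<forall>x\<in>S. set_pmf (P t x) \<subseteq> S) \<and>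
     (\<forall>x\<in>S. P 0 x = return_pmf x) \<and>
     (\<forall>s\<ge>0. \<forall>t\<ge>0. \<forall>x\<in>S. P (s + t) x = bind_pmf (P s x) (P t))"

text \<open>If the jump rates underlying \<open>L\<close> are bounded, as they are for \<open>queue_generator\<close>, this
  determines the semigroup uniquely on \<open>S\<close>.\<close>
definition has_generator_on ::
  "'a set \<Rightarrow> (real \<Rightarrow> 'a \<Rightarrow> 'a pmf) \<Rightarrow> (('a \<Rightarrow> real) \<Rightarrow> 'a \<Rightarrow> real) \<Rightarrow> bool" where
  "has_generator_on S P L \<longleftrightarrow>
     (\<forall>f. bounded (f ` S) \<longrightarrow> (\<forall>x\<in>S.
       ((\<lambda>t. (measure_pmf.expectation (P t x) f - f x) / t) \<longlongrightarrow> L f x) (at_right 0)))"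

definition queue_semigroup ::
  "nat \<Rightarrow> real \<Rightarrow> (real \<Rightarrow> real) \<Rightarrow> real \<Rightarrow> (real \<Rightarrow> (nat \<Rightarrow> nat) \<Rightarrow> (nat \<Rightarrow> nat) pmf) \<Rightarrow> bool" where
  "queue_semigroup N B l lam P \<longleftrightarrow>
     markov_semigroup_on (queue_states N) P \<and>
     has_generator_on (queue_states N) P (queue_generator N B l lam)"

definition invariant_distribution_on ::
  "'a set \<Rightarrow> (real \<Rightarrow> 'a \<Rightarrow> 'a pmf) \<Rightarrow> 'a pmf \<Rightarrow> bool" where
  "invariant_distribution_on S P p \<longleftrightarrow> set_pmf p \<subseteq> S \<and> (\<forall>t\<ge>0. bind_pmf p (P t) = p)"

text \<open>The total variation norm of the signed measure \<open>p - q\<close>, by duality with bounded functions;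
  it is twice the supremum of \<open>\<bar>p A - q A\<bar>\<close> over all events \<open>A\<close>.\<close>
definition tv_norm_diff :: "'a pmf \<Rightarrow> 'a pmf \<Rightarrow> real" where
  "tv_norm_diff p q =
     (SUP f\<in>{f :: 'a \<Rightarrow> real. \<forall>x. \<bar>f x\<bar> \<le> 1}.
        \<bar>measure_pmf.expectation p f - measure_pmf.expectation q f\<bar>)"

end

theory Submission
  imports Defs
begin

text \<open>
  A service rate never falls below the critical rate \<open>\<mu>\<close>, its value when all the other
  queues interfere. So each nonempty queue drifts down at a rate of at least \<open>\<mu> - lam > 0\<close>, and for
  \<open>1 < \<rho> < \<mu> / lam\<close> the function \<open>V q = (\<Sum>i\<in>{1..N}. \<rho> ^ q i)\<close> satisfies the Foster--Lyapunov inequality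
  \<open>L V \<le> - c V + b\<close>.

  Let two copies run independently from \<open>x\<close> and \<open>y\<close> until both are empty at the same time,
  and together afterwards. The distance of their laws is controlled by the tail of this meeting time,
  hence by a function \<open>W\<close> of both states that the pair generator contracts at
  every pair but the empty one. Such a \<open>W\<close> is \<open>V x + V y\<close> plus a multiple of
  \<open>1 - \<theta> ^ n\<close>, with \<open>n\<close> the number of jobs in both copies (\<open>pair_drift_exists\<close>).

  No coupled process is constructed. For a test function \<open>f\<close> with values in \<open>[-1, 1]\<close>, the difference
  \<open>P\<^sub>t f x - P\<^sub>t f y\<close> solves the backward equation of the pair generator, vanishes at the
  empty pair and is bounded by 2. A maximum principle compares it with the supersolution
  \<open>2 exp (- \<kappa> t) W x y\<close> (\<open>pair_contraction\<close>). Only finitely many pairs can violate the comparison before a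
  given time, because \<open>W\<close> has finite sublevel sets, and for finitely many coordinates the principle is a
  continuous induction (\<open>nonneg_if_increasing_at_zeros\<close>). Compared with truncations of \<open>V\<close>,
  the same principle bounds the moments uniformly in time, so that \<open>V\<close> is integrable under the invariant
  distribution (\<open>integrable_exp_moment_invariant\<close>). Averaging the contraction over \<open>y\<close> then gives the theorem.
\<close>

section \<open>A maximum principle in continuous time\<close>

text \<open>Continuous induction. At a time up to which \<open>h\<close> is nonnegative, every coordinate that
  vanishes is about to grow, and every other coordinate stays positive for a while by continuity;
  as only finitely many coordinates matter, one positive amount of time works
  for all of them.\<close>
lemma nonneg_if_increasing_at_zeros:
  fixes h :: "real \<Rightarrow> 'a \<Rightarrow> real"
  assumes "finite F"
    and cont: "\<And>p. p \<in> F \<Longrightarrow> continuous_on {0..} (\<lambda>t. h t p)"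
    and init: "\<And>p. p \<in> F \<Longrightarrow> 0 \<le> h 0 p"
    and increasing: "\<And>t p. \<lbrakk>p \<in> F; 0 \<le> t; t < T; \<And>q. q \<in> F \<Longrightarrow> 0 \<le> h t q; h t p = 0\<rbrakk>
      \<Longrightarrow> \<exists>d>0. ((\<lambda>s. (h (t + s) p - h t p) / s) \<longlongrightarrow> d) (at_right 0)"
    and "p \<in> F" "0 \<le> t" "t \<le> T"
  shows "0 \<le> h t p"
proof (rule ccontr)
  assume neg: "\<not> 0 \<le> h t p"
  define A where "A = {s. 0 \<le> s \<and> s \<le> T \<and> (\<exists>q\<in>F. h s q < 0)}"
  have tA: "t \<in> A"
    using neg assms by (auto simp: A_def not_le)
  have bdd: "bdd_below A"
    by (rule bdd_belowI[of _ 0]) (auto simp: A_def)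
  define a where "a = Inf A"
  have a_le: "a \<le> s" if "s \<in> A" for s
    unfolding a_def by (rule cInf_lower[OF that bdd])
  have "0 \<le> a"
    unfolding a_def by (rule cInf_greatest) (use tA in \<open>auto simp: A_def\<close>)
  have "a \<le> T"
    using a_le[OF tA] assms by simp
  have before: "0 \<le> h s q" if "0 \<le> s" "s < a" "q \<in> F" for s q
    using a_le[of s] that \<open>a \<le> T\<close> by (force simp: A_def)
  have at_a: "0 \<le> h a q" if "q \<in> F" for q
  proof (cases "a = 0")
    case True
    then show ?thesis using init that by simp
  next
    case False
    with \<open>0 \<le> a\<close> have "0 < a" by simp
    have "continuous (at a within {0..}) (\<lambda>s. h s q)"
      using cont[OF that] \<open>0 \<le> a\<close> by (auto simp: continuous_on_eq_continuous_within)
    then have "((\<lambda>s. h s q) \<longlongrightarrow> h a q) (at a within {0..})"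
      by (simp add: continuous_within)
    then have "((\<lambda>s. h s q) \<longlongrightarrow> h a q) (at a within {0..<a})"
      by (rule tendsto_within_subset) auto
    moreover have "at a within {0..<a} = at_left a"
      using \<open>0 < a\<close> by (intro at_within_nhd[of _ "{0<..}"]) auto
    moreover have "\<forall>\<^sub>F s in at_left a. 0 \<le> h s q"
      using eventually_at_left_real[OF \<open>0 < a\<close>] by eventually_elim (use before that in auto)
    ultimately show ?thesis
      by (intro tendsto_lowerbound[where F="at_left a"]) auto
  qed
  have "a \<noteq> T"
    using at_a tA a_le assms neg by (metis order_antisym)
  with \<open>a \<le> T\<close> have "a < T" by simp
  have "\<forall>\<^sub>F s in at_right 0. 0 \<le> h (a + s) q" if q: "q \<in> F" for q
  proof (cases "h a q = 0")
    case True
    obtain d where "d > 0" and d: "((\<lambda>s. (h (a + s) q - h a q) / s) \<longlongrightarrow> d) (at_right 0)"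
      using increasing[OF q \<open>0 \<le> a\<close> \<open>a < T\<close> at_a True] by blast
    have "\<forall>\<^sub>F s in at_right 0. 0 < (h (a + s) q - h a q) / s"
      using order_tendstoD(1)[OF d \<open>d > 0\<close>] .
    moreover have "\<forall>\<^sub>F s in at_right 0. 0 < (s::real)"
      by (simp add: eventually_at_right_less)
    ultimately show ?thesis
      by eventually_elim (use True in \<open>auto simp: zero_less_divide_iff\<close>)
  next
    case False
    with at_a[OF q] have "0 < h a q" by simp
    have "((\<lambda>s. h s q) \<longlongrightarrow> h a q) (at a within {0..})"
      using cont[OF q] \<open>0 \<le> a\<close> by (auto simp: continuous_on_eq_continuous_within continuous_within)
    then have "((\<lambda>s. h s q) \<longlongrightarrow> h a q) (at_right a)"
      by (rule tendsto_within_subset) (use \<open>0 \<le> a\<close> in auto)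
    then have "\<forall>\<^sub>F s in at_right a. 0 < h s q"
      using order_tendstoD(1) \<open>0 < h a q\<close> by blast
    then show ?thesis
      unfolding eventually_at_right_to_0[of _ a]
      by eventually_elim (simp add: add.commute)
  qed
  then have "\<forall>\<^sub>F s in at_right 0. \<forall>q\<in>F. 0 \<le> h (a + s) q"
    by (intro eventually_ball_finite \<open>finite F\<close>) auto
  then obtain e where "e > 0" and e: "\<And>s q. 0 < s \<Longrightarrow> s < e \<Longrightarrow> q \<in> F \<Longrightarrow> 0 \<le> h (a + s) q"
    unfolding eventually_at_right_field by auto
  have "a + e \<le> s" if "s \<in> A" for s
    using a_le[OF that] e[of "s - a"] at_a that by (force simp: A_def not_le)
  then have "a + e \<le> Inf A"
    using tA by (intro cInf_greatest) auto
  with \<open>e > 0\<close> show False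
    by (simp add: a_def)
qed

lemma exp_right_derivative:
  "((\<lambda>s. (exp (- c * (t + s)) - exp (- c * t)) / s) \<longlongrightarrow> - c * exp (- c * t)) (at_right (0::real))"
proof -
  have "((\<lambda>r. exp (- c * r)) has_real_derivative exp (- c * t) * (- c)) (at t)"
    by (auto intro!: derivative_eq_intros)
  then have "(\<lambda>s. (exp (- c * (t + s)) - exp (- c * t)) / s) \<midarrow>0\<rightarrow> exp (- c * t) * (- c)"
    by (simp only: DERIV_def)
  then show ?thesis
    by (simp add: filterlim_at_split mult.commute)
qed

section \<open>Semigroups of discrete distributions\<close>

lemma integrable_measure_pmf_bounded:
  fixes f :: "'a \<Rightarrow> real"
  assumes "\<And>x. \<bar>f x\<bar> \<le> c"
  shows "integrable (measure_pmf p) f"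
  by (rule measure_pmf.integrable_const_bound[where B=c]) (use assms in auto)

lemma abs_expectation_le:
  fixes f :: "'a \<Rightarrow> real"
  assumes "\<And>x. \<bar>f x\<bar> \<le> c"
  shows "\<bar>measure_pmf.expectation p f\<bar> \<le> c"
proof -
  have "\<bar>measure_pmf.expectation p f\<bar> \<le> measure_pmf.expectation p (\<lambda>x. \<bar>f x\<bar>)"
    by (rule integral_abs_bound)
  also have "\<dots> \<le> measure_pmf.expectation p (\<lambda>_. c)"
    by (rule integral_mono)
       (use assms integrable_measure_pmf_bounded[where f=f and c=c, OF assms] in auto)
  finally show ?thesis by simp
qed

text \<open>For nonnegative functions this is the rule for nonnegative integrals; adding the bound \<open>c\<close> to \<open>f\<close>
  reduces the general case to it.\<close>
lemma expectation_bind_pmf: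
  fixes f :: "'b \<Rightarrow> real"
  assumes f: "\<And>x. \<bar>f x\<bar> \<le> c"
  shows "measure_pmf.expectation (bind_pmf p K) f
    = measure_pmf.expectation p (\<lambda>x. measure_pmf.expectation (K x) f)"
proof -
  have int: "integrable (measure_pmf r) f" for r
    using f by (rule integrable_measure_pmf_bounded)
  have intK: "integrable (measure_pmf p) (\<lambda>x. measure_pmf.expectation (K x) f)"
    by (rule integrable_measure_pmf_bounded[of _ c]) (intro abs_expectation_le f)
  have pos: "0 \<le> f y + c" for y
    using f[of y] by (simp add: abs_le_iff)
  have posK: "0 \<le> measure_pmf.expectation (K x) f + c" for x
    using abs_expectation_le[where f=f, OF f, of "K x"] by (simp add: abs_le_iff)
  have nn: "ennreal (measure_pmf.expectation r f + c) = (\<integral>\<^sup>+ y. ennreal (f y + c) \<partial>measure_pmf r)" for r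
    by (subst nn_integral_eq_integral) (use int pos in auto)
  have "ennreal (measure_pmf.expectation (bind_pmf p K) f + c)
      = (\<integral>\<^sup>+ x. ennreal (measure_pmf.expectation (K x) f + c) \<partial>measure_pmf p)"
    by (simp add: nn)
  also have "\<dots> = ennreal (measure_pmf.expectation p (\<lambda>x. measure_pmf.expectation (K x) f) + c)"
    by (subst nn_integral_eq_integral) (use intK posK in auto)
  finally have "ennreal (measure_pmf.expectation (bind_pmf p K) f + c)
      = ennreal (measure_pmf.expectation p (\<lambda>x. measure_pmf.expectation (K x) f) + c)" .
  moreover have "0 \<le> measure_pmf.expectation (bind_pmf p K) f + c"
    using abs_expectation_le[where f=f, OF f, of "bind_pmf p K"] by (simp add: abs_le_iff)
  moreover have "0 \<le> measure_pmf.expectation p (\<lambda>x. measure_pmf.expectation (K x) f) + c"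
    using abs_expectation_le[of "\<lambda>x. measure_pmf.expectation (K x) f" c p] abs_expectation_le[where f=f, OF f]
    by (simp add: abs_le_iff)
  ultimately show ?thesis by simp
qed

locale generated_semigroup =
  fixes S :: "'a set" and P :: "real \<Rightarrow> 'a \<Rightarrow> 'a pmf" and L :: "('a \<Rightarrow> real) \<Rightarrow> 'a \<Rightarrow> real"
  assumes semigroup: "markov_semigroup_on S P"
    and generator: "has_generator_on S P L"
begin

abbreviation evolve :: "('a \<Rightarrow> real) \<Rightarrow> real \<Rightarrow> 'a \<Rightarrow> real" where
  "evolve f t x \<equiv> measure_pmf.expectation (P t x) f"

lemma evolve_0: "x \<in> S \<Longrightarrow> evolve f 0 x = f x"
  using semigroup by (simp add: markov_semigroup_on_def)

lemma evolve_add: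
  assumes "\<And>x. \<bar>f x\<bar> \<le> c" "0 \<le> s" "0 \<le> t" "x \<in> S"
  shows "evolve f (s + t) x = evolve (evolve f t) s x"
  using semigroup assms expectation_bind_pmf[of f c "P s x" "P t"]
  by (simp add: markov_semigroup_on_def)

lemma generator_at_right:
  assumes "\<And>x. \<bar>f x\<bar> \<le> c" "x \<in> S"
  shows "((\<lambda>t. (evolve f t x - f x) / t) \<longlongrightarrow> L f x) (at_right 0)"
proof -
  have "bounded (f ` S)"
    using assms by (auto simp: bounded_iff)
  then show ?thesis
    using generator assms by (simp add: has_generator_on_def)
qed

text \<open>The backward equation. By the semigroup property the increment from time \<open>t\<close> on is the initial
  increment for the bounded function \<open>evolve f t\<close>, to which the generator applies directly.\<close>
lemma backward_equation:
  assumes f: "\<And>x. \<bar>f x\<bar> \<le> c" and "x \<in> S" "0 \<le> t"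
  shows "((\<lambda>s. (evolve f (t + s) x - evolve f t x) / s) \<longlongrightarrow> L (evolve f t) x) (at_right 0)"
proof -
  have "((\<lambda>s. (evolve (evolve f t) s x - evolve f t x) / s) \<longlongrightarrow> L (evolve f t) x) (at_right 0)"
    by (rule generator_at_right[of _ c]) (use assms abs_expectation_le[where f=f, OF f] in auto)
  moreover have "\<forall>\<^sub>F s in at_right 0. evolve (evolve f t) s x = evolve f (t + s) x"
    using eventually_at_right_less[of "0::real"]
    by eventually_elim (use assms evolve_add[where f=f, OF f] in \<open>simp add: add.commute\<close>)
  ultimately show ?thesis
    by (elim Lim_transform_eventually) (auto elim: eventually_mono)
qed

text \<open>The generator at the indicator of \<open>{x}\<close> is finite, so the probability of having left \<open>x\<close> is of order \<open>t\<close>.\<close>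
lemma holding_probability_tendsto:
  assumes "x \<in> S"
  shows "((\<lambda>t. pmf (P t x) x) \<longlongrightarrow> 1) (at_right 0)"
proof -
  let ?f = "indicator {x} :: 'a \<Rightarrow> real"
  have ev: "evolve ?f t x = pmf (P t x) x" for t
    by (simp add: pmf.rep_eq)
  have "((\<lambda>t. (pmf (P t x) x - 1) / t) \<longlongrightarrow> L ?f x) (at_right 0)"
    using generator_at_right[of ?f 1 x] assms ev by (simp add: indicator_def)
  then have "((\<lambda>t. (pmf (P t x) x - 1) / t * t + 1) \<longlongrightarrow> L ?f x * 0 + 1) (at_right 0)"
    by (intro tendsto_intros)
  moreover have "\<forall>\<^sub>F t in at_right 0. (pmf (P t x) x - 1) / t * t + 1 = pmf (P t x) x"
    using eventually_at_right_less[of "0::real"] by eventually_elim simp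
  ultimately show ?thesis
    by (auto elim: Lim_transform_eventually)
qed

text \<open>By the semigroup property \<open>evolve f t\<close> is evaluated at the state after time \<open>s\<close> on the one hand
  and at \<open>x\<close> on the other; these differ only if the chain has left \<open>x\<close>. As the
  bound does not depend on \<open>t\<close>, it gives continuity from the left as well.\<close>
lemma evolve_increment_le:
  assumes f: "\<And>x. \<bar>f x\<bar> \<le> c" and "x \<in> S" "0 \<le> s" "0 \<le> t"
  shows "\<bar>evolve f (t + s) x - evolve f t x\<bar> \<le> 2 * c * (1 - pmf (P s x) x)"
proof -
  let ?g = "evolve f t"
  have g: "\<bar>?g y\<bar> \<le> c" for y
    by (rule abs_expectation_le[where f=f, OF f])
  have int: "integrable (measure_pmf (P s x)) (\<lambda>y. ?g y - ?g x)"
    using integrable_measure_pmf_bounded[where f="?g", OF g] by simp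
  have ind: "integrable (measure_pmf (P s x)) (\<lambda>y. indicator (- {x}) y * (2 * c) :: real)"
    by (rule integrable_measure_pmf_bounded[where c="\<bar>2 * c\<bar>"]) (auto simp: indicator_def)
  have "evolve f (t + s) x - ?g x = measure_pmf.expectation (P s x) (\<lambda>y. ?g y - ?g x)"
    using evolve_add[where f=f, OF f, of s t x] assms integrable_measure_pmf_bounded[where f="?g", OF g]
    by (simp add: add.commute)
  also have "\<bar>\<dots>\<bar> \<le> measure_pmf.expectation (P s x) (\<lambda>y. \<bar>?g y - ?g x\<bar>)"
    by (rule integral_abs_bound)
  also have "\<dots> \<le> measure_pmf.expectation (P s x) (\<lambda>y. indicator (- {x}) y * (2 * c))"
  proof (rule integral_mono[OF integrable_abs[OF int] ind])
    fix y show "\<bar>?g y - ?g x\<bar> \<le> indicator (- {x}) y * (2 * c)"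
      using g[of x] g[of y] by (cases "y = x") (auto simp: abs_le_iff)
  qed
  also have "\<dots> = measure_pmf.prob (P s x) (- {x}) * (2 * c)"
    by simp
  also have "measure_pmf.prob (P s x) (- {x}) = 1 - pmf (P s x) x"
    using measure_pmf.prob_compl[of "{x}" "P s x"] by (simp add: pmf.rep_eq Compl_eq_Diff_UNIV)
  finally show ?thesis
    by (simp add: mult.commute)
qed

lemma continuous_on_evolve:
  assumes f: "\<And>x. \<bar>f x\<bar> \<le> c" and x: "x \<in> S"
  shows "continuous_on {0..} (\<lambda>t. evolve f t x)"
proof (rule continuous_onI)
  fix t e :: real
  assume t: "t \<in> {0..}" and "0 < e"
  have "((\<lambda>s. 2 * c * (1 - pmf (P s x) x)) \<longlongrightarrow> 2 * c * (1 - 1)) (at_right 0)"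
    by (intro tendsto_intros holding_probability_tendsto x)
  then have "\<forall>\<^sub>F s in at_right 0. 2 * c * (1 - pmf (P s x) x) < e"
    using order_tendstoD(2) \<open>0 < e\<close> by fastforce
  then obtain d where "d > 0" and d: "\<And>s. 0 < s \<Longrightarrow> s < d \<Longrightarrow> 2 * c * (1 - pmf (P s x) x) < e"
    unfolding eventually_at_right_field by auto
  have near: "\<bar>evolve f b x - evolve f a x\<bar> < e" if "0 \<le> a" "a < b" "b - a < d" for a b
    using evolve_increment_le[where f=f, OF f x, of "b - a" a] d[of "b - a"] that by simp
  show "\<exists>d>0. \<forall>s\<in>{0..}. dist s t < d \<longrightarrow> dist (evolve f s x) (evolve f t x) \<le> e"
  proof (intro exI[of _ d] conjI ballI impI \<open>d > 0\<close>)
    fix s :: real assume s: "s \<in> {0..}" "dist s t < d"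
    consider "s = t" | "s < t" | "t < s" by linarith
    then show "dist (evolve f s x) (evolve f t x) \<le> e"
    proof cases
      case 1 then show ?thesis using \<open>0 < e\<close> by simp
    next
      case 2 then show ?thesis using near[of s t] s t by (simp add: dist_real_def)
    next
      case 3 then show ?thesis using near[of t s] s t by (simp add: dist_real_def)
    qed
  qed
qed

end

section \<open>The generator of the queues\<close>

lemma path_loss_nonneg: "path_loss l \<Longrightarrow> 0 \<le> l r"
  by (auto simp: path_loss_def)

lemma critical_rate_le_service_rate:
  assumes "path_loss l" "0 \<le> B" "i \<in> {1..N}"
  shows "critical_rate N B l \<le> service_rate N B l i q"
proof -
  have l: "0 \<le> l r" for r
    using assms(1) by (rule path_loss_nonneg)
  let ?s = "\<Sum>j\<in>{1..N} - {i}. of_bool (q j > 0) * l (circ_dist N i j)"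
  have s0: "0 \<le> ?s"
    by (intro sum_nonneg) (simp add: l)
  have "?s \<le> (\<Sum>j\<in>{1..N} - {i}. l (circ_dist N i j))"
    by (intro sum_mono) (simp add: l)
  then have "?s \<le> total_interference N l"
    using total_interference_eq[OF assms(3)] by simp
  then have "1 / (1 + total_interference N l) \<le> 1 / (1 + ?s)"
    using s0 by (intro divide_left_mono) auto
  moreover have "0 < 1 + 1 / (1 + total_interference N l)"
    using s0 \<open>?s \<le> total_interference N l\<close> by (intro add_pos_nonneg) auto
  moreover have "0 < 1 + 1 / (1 + ?s)"
    using s0 by (intro add_pos_nonneg) auto
  ultimately have "log 2 (1 + 1 / (1 + total_interference N l)) \<le> log 2 (1 + 1 / (1 + ?s))"
    by (intro iffD2[OF log_le_cancel_iff]) linarith+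
  then show ?thesis
    unfolding critical_rate_def service_rate_def using assms(2) by (rule mult_left_mono)
qed

definition total_jobs :: "nat \<Rightarrow> (nat \<Rightarrow> nat) \<Rightarrow> nat" where
  "total_jobs N q = (\<Sum>i\<in>{1..N}. q i)"

lemma total_jobs_arrival:
  assumes "i \<in> {1..N}"
  shows "total_jobs N (q(i := q i + 1)) = Suc (total_jobs N q)"
proof -
  have "total_jobs N r = r i + (\<Sum>j\<in>{1..N} - {i}. r j)" for r
    unfolding total_jobs_def using assms by (intro sum.remove) auto
  then show ?thesis by simp
qed

lemma total_jobs_departure:
  assumes "i \<in> {1..N}" "q i > 0"
  shows "Suc (total_jobs N (q(i := q i - 1))) = total_jobs N q"
proof -
  have "total_jobs N r = r i + (\<Sum>j\<in>{1..N} - {i}. r j)" for r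
    unfolding total_jobs_def using assms by (intro sum.remove) auto
  then show ?thesis using assms by simp
qed

lemma nonempty_queue_exists:
  assumes "q \<in> queue_states N" "q \<noteq> (\<lambda>_. 0)"
  obtains i where "i \<in> {1..N}" "q i > 0"
proof -
  from assms(2) obtain i where "q i \<noteq> 0" by blast
  moreover have "i \<in> {1..N}"
    using assms(1) \<open>q i \<noteq> 0\<close> by (intro ccontr[of "i \<in> {1..N}"]) (simp add: queue_states_def)
  ultimately show thesis using that by simp
qed

lemma finite_bounded_total_jobs: "finite {q \<in> queue_states N. total_jobs N q \<le> n}"
proof (rule finite_subset)
  show "{q \<in> queue_states N. total_jobs N q \<le> n}
      \<subseteq> {q. \<forall>i. (i \<in> {1..N} \<longrightarrow> q i \<in> {..n}) \<and> (i \<notin> {1..N} \<longrightarrow> q i = 0)}"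
  proof (safe; simp)
    fix q i assume q: "q \<in> queue_states N" "total_jobs N q \<le> n"
    {
      assume i: "Suc 0 \<le> i \<and> i \<le> N"
      have "q i \<le> total_jobs N q"
        unfolding total_jobs_def using i by (intro member_le_sum) auto
      then show "q i \<le> n" using q by simp
    }
    show "(Suc 0 \<le> i \<longrightarrow> \<not> i \<le> N) \<Longrightarrow> q i = 0"
      using q by (auto simp: queue_states_def)
  qed
  show "finite {q. \<forall>i. (i \<in> {1..N} \<longrightarrow> q i \<in> {..n}) \<and> (i \<notin> {1..N} \<longrightarrow> q i = 0)}"
    by (rule finite_set_of_finite_funs) auto
qed

lemma queue_states_update:
  "q \<in> queue_states N \<Longrightarrow> i \<in> {1..N} \<Longrightarrow> q(i := k) \<in> queue_states N"
  by (auto simp: queue_states_def)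

lemma queue_generator_affine:
  "queue_generator N B l lam (\<lambda>x. a * f x + b * g x + c) q
    = a * queue_generator N B l lam f q + b * queue_generator N B l lam g q"
proof -
  have "(\<Sum>i\<in>{1..N}. (a * f (q(i := q i + 1)) + b * g (q(i := q i + 1)) + c) - (a * f q + b * g q + c))
      = a * (\<Sum>i\<in>{1..N}. f (q(i := q i + 1)) - f q) + b * (\<Sum>i\<in>{1..N}. g (q(i := q i + 1)) - g q)"
    unfolding sum_distrib_left sum.distrib[symmetric]
    by (intro sum.cong refl) (simp add: algebra_simps)
  moreover have "(\<Sum>i\<in>{1..N}. service_rate N B l i q *
        ((a * f q + b * g q + c) - (a * f (q(i := q i - 1)) + b * g (q(i := q i - 1)) + c)) * of_bool (q i > 0))
      = a * (\<Sum>i\<in>{1..N}. service_rate N B l i q * (f q - f (q(i := q i - 1))) * of_bool (q i > 0))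
        + b * (\<Sum>i\<in>{1..N}. service_rate N B l i q * (g q - g (q(i := q i - 1))) * of_bool (q i > 0))"
    unfolding sum_distrib_left sum.distrib[symmetric]
    by (intro sum.cong refl) (simp add: algebra_simps)
  ultimately show ?thesis
    unfolding queue_generator_def by (simp only:) (simp only: algebra_simps)
qed

text \<open>At a minimum, jumps can only lead upwards. This is the property of the generator on which the
  maximum principle rests.\<close>
lemma queue_generator_nonneg_at_min:
  assumes "\<And>i. i \<in> {1..N} \<Longrightarrow> 0 \<le> service_rate N B l i q" "0 \<le> lam"
    and "\<And>x. x \<in> queue_states N \<Longrightarrow> 0 \<le> f x" "f q = 0" "q \<in> queue_states N"
  shows "0 \<le> queue_generator N B l lam f q"
proof -
  have "0 \<le> (\<Sum>i\<in>{1..N}. f (q(i := q i + 1)))"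
    by (intro sum_nonneg assms(3) queue_states_update assms(5))
  moreover have "0 \<le> (\<Sum>i\<in>{1..N}. service_rate N B l i q * f (q(i := q i - 1)) * of_bool (q i > 0))"
    by (intro sum_nonneg mult_nonneg_nonneg assms(1,3) queue_states_update assms(5)) auto
  ultimately show ?thesis
    using assms(2,4) by (simp add: queue_generator_def sum_negf)
qed

section \<open>Lyapunov functions\<close>

definition exp_moment :: "nat \<Rightarrow> real \<Rightarrow> (nat \<Rightarrow> nat) \<Rightarrow> real" where
  "exp_moment N \<rho> q = (\<Sum>i\<in>{1..N}. \<rho> ^ q i)"

lemma exp_moment_diff:
  assumes "i \<in> {1..N}"
  shows "exp_moment N \<rho> (q(i := k)) - exp_moment N \<rho> q = \<rho> ^ k - \<rho> ^ q i"
proof -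
  have "exp_moment N \<rho> r = \<rho> ^ r i + (\<Sum>j\<in>{1..N} - {i}. \<rho> ^ r j)" for r
    unfolding exp_moment_def using assms by (intro sum.remove) auto
  then show ?thesis by simp
qed

text \<open>Bernoulli's inequality. It yields the finite sublevel sets and, with \<open>N > 0\<close>, the lower bound 1 for the
  exponential moment.\<close>
lemma total_jobs_le_exp_moment:
  assumes "1 < \<rho>"
  shows "real (total_jobs N q) * (\<rho> - 1) + real N \<le> exp_moment N \<rho> q"
proof -
  have "(\<Sum>i\<in>{1..N}. 1 + real (q i) * (\<rho> - 1)) \<le> exp_moment N \<rho> q"
    unfolding exp_moment_def
  proof (rule sum_mono)
    fix i show "1 + real (q i) * (\<rho> - 1) \<le> \<rho> ^ q i"
      using Bernoulli_inequality[of "\<rho> - 1" "q i"] assms by simp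
  qed
  then show ?thesis
    by (simp add: sum.distrib total_jobs_def sum_distrib_right)
qed

lemma finite_exp_moment_le:
  assumes "1 < \<rho>"
  shows "finite {q \<in> queue_states N. exp_moment N \<rho> q \<le> a}"
proof (rule finite_subset)
  show "{q \<in> queue_states N. exp_moment N \<rho> q \<le> a} \<subseteq> {q \<in> queue_states N. total_jobs N q \<le> nat \<lceil>a / (\<rho> - 1)\<rceil>}"
  proof safe
    fix q assume "exp_moment N \<rho> q \<le> a"
    then have "real (total_jobs N q) * (\<rho> - 1) \<le> a"
      using total_jobs_le_exp_moment[OF assms, of N q] by simp
    then have "real (total_jobs N q) \<le> a / (\<rho> - 1)"
      using assms by (simp add: field_simps)
    then show "total_jobs N q \<le> nat \<lceil>a / (\<rho> - 1)\<rceil>"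
      by linarith
  qed
qed (rule finite_bounded_total_jobs)

lemma exp_moment_nonneg: "1 < \<rho> \<Longrightarrow> 0 \<le> exp_moment N \<rho> q"
  by (simp add: exp_moment_def sum_nonneg)

text \<open>The estimate is made queue by queue. A nonempty queue contributes at most
  \<open>- c * \<rho> ^ q i\<close>; an empty one contributes \<open>(\<rho> - 1) * lam\<close>, and the \<open>c\<close> in the constant makes up for
  \<open>- c * \<rho> ^ 0\<close>.\<close>
lemma exp_moment_drift:
  assumes "0 < lam" "1 < \<rho>" "\<rho> * lam < \<mu>"
    and \<mu>: "\<And>i. i \<in> {1..N} \<Longrightarrow> \<mu> \<le> service_rate N B l i q"
    and c: "c = (\<rho> - 1) * (\<mu> / \<rho> - lam)"
  shows "queue_generator N B l lam (exp_moment N \<rho>) q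
    \<le> - c * exp_moment N \<rho> q + real N * ((\<rho> - 1) * lam + c)"
proof -
  let ?s = "\<lambda>i. service_rate N B l i q"
  have "lam \<le> \<mu> / \<rho>"
    using assms(2,3) by (simp add: pos_le_divide_eq mult.commute)
  then have c0: "0 \<le> c"
    unfolding c using assms(2) by (intro mult_nonneg_nonneg) auto
  have coord: "lam * (\<rho> ^ (q i + 1) - \<rho> ^ q i) - ?s i * (\<rho> ^ q i - \<rho> ^ (q i - 1)) * of_bool (q i > 0)
      \<le> - c * \<rho> ^ q i + ((\<rho> - 1) * lam + c)" if i: "i \<in> {1..N}" for i
  proof (cases "q i")
    case 0
    then show ?thesis by (simp add: left_diff_distrib mult.commute)
  next
    case (Suc k)
    have "\<mu> * (\<rho> ^ k * (\<rho> - 1)) \<le> ?s i * (\<rho> ^ k * (\<rho> - 1))"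
      using \<mu>[OF i] assms by (intro mult_right_mono) auto
    moreover have "\<mu> * (\<rho> ^ k * (\<rho> - 1)) = (\<mu> / \<rho>) * (\<rho> ^ Suc k * (\<rho> - 1))"
      using assms by simp
    moreover have "0 \<le> (\<rho> - 1) * lam + c"
      using assms c0 by simp
    ultimately have "lam * (\<rho> ^ Suc k * (\<rho> - 1)) - ?s i * (\<rho> ^ k * (\<rho> - 1))
        \<le> (lam - \<mu> / \<rho>) * (\<rho> ^ Suc k * (\<rho> - 1)) + ((\<rho> - 1) * lam + c)"
      unfolding left_diff_distrib by linarith
    also have "(lam - \<mu> / \<rho>) * (\<rho> ^ Suc k * (\<rho> - 1)) = - c * \<rho> ^ Suc k"
      by (simp only: c) algebra
    finally show ?thesis
      by (simp only: Suc) (simp add: algebra_simps)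
  qed
  have "queue_generator N B l lam (exp_moment N \<rho>) q
      = (\<Sum>i\<in>{1..N}. lam * (\<rho> ^ (q i + 1) - \<rho> ^ q i)
          - ?s i * (\<rho> ^ q i - \<rho> ^ (q i - 1)) * of_bool (q i > 0))"
  proof -
    have "exp_moment N \<rho> q - exp_moment N \<rho> (q(i := q i - 1)) = \<rho> ^ q i - \<rho> ^ (q i - 1)"
      if "i \<in> {1..N}" for i
      using exp_moment_diff[OF that, of \<rho> q "q i - 1"] by simp
    then show ?thesis
      unfolding queue_generator_def sum_distrib_left sum_subtractf[symmetric]
      by (intro sum.cong refl) (simp add: exp_moment_diff)
  qed
  also have "\<dots> \<le> (\<Sum>i\<in>{1..N}. - c * \<rho> ^ q i + ((\<rho> - 1) * lam + c))"
    by (intro sum_mono coord)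
  also have "\<dots> = - c * exp_moment N \<rho> q + real N * ((\<rho> - 1) * lam + c)"
    unfolding exp_moment_def sum_distrib_left sum.distrib by (simp add: distrib_left)
  finally show ?thesis .
qed

text \<open>Every arrival multiplies \<open>\<theta> ^ total_jobs N q\<close> by \<open>\<theta>\<close> and every departure divides it by
  \<open>\<theta>\<close>, so only the total departure rate matters.\<close>
lemma geometric_generator:
  assumes "0 < \<theta>"
  shows "queue_generator N B l lam (\<lambda>x. \<theta> ^ total_jobs N x) q
    = \<theta> ^ total_jobs N q * (1 - \<theta>) *
      ((\<Sum>i\<in>{1..N}. service_rate N B l i q * of_bool (q i > 0)) / \<theta> - real N * lam)"
proof -
  let ?n = "total_jobs N q"
  have dep: "service_rate N B l i q * (\<theta> ^ ?n - \<theta> ^ total_jobs N (q(i := q i - 1))) * of_bool (q i > 0)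
      = - (\<theta> ^ ?n * (1 - \<theta>) / \<theta>) * (service_rate N B l i q * of_bool (q i > 0))"
    if "i \<in> {1..N}" for i
  proof (cases "q i > 0")
    case True
    have eq: "\<theta> ^ ?n = \<theta> * \<theta> ^ total_jobs N (q(i := q i - 1))"
      using total_jobs_departure[of i N q, OF that True] by (metis power_Suc)
    show ?thesis
      unfolding eq using assms True by (simp add: field_simps)
  qed simp
  have arr: "\<theta> ^ total_jobs N (q(i := q i + 1)) - \<theta> ^ ?n = - (\<theta> ^ ?n * (1 - \<theta>))"
    if "i \<in> {1..N}" for i
    unfolding total_jobs_arrival[OF that] by (simp add: algebra_simps)
  have arrivals: "(\<Sum>i\<in>{1..N}. \<theta> ^ total_jobs N (q(i := q i + 1)) - \<theta> ^ ?n)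
      = - real N * (\<theta> ^ ?n * (1 - \<theta>))"
    by (simp only: arr cong: sum.cong) simp
  have departures: "(\<Sum>i\<in>{1..N}. service_rate N B l i q *
        (\<theta> ^ ?n - \<theta> ^ total_jobs N (q(i := q i - 1))) * of_bool (q i > 0))
      = - (\<theta> ^ ?n * (1 - \<theta>) / \<theta>) * (\<Sum>i\<in>{1..N}. service_rate N B l i q * of_bool (q i > 0))"
    unfolding sum_distrib_left by (intro sum.cong refl dep)
  show ?thesis
    unfolding queue_generator_def arrivals departures divide_inverse by algebra
qed

text \<open>The exponential moments contract only outside a finite set. The bounded last
  term repairs that set: for small \<open>\<theta>\<close> a departure moves it far more than an arrival does, so
  its mean decreases at every pair but the empty one, where there are no departures.\<close>
definition pair_lyapunov ::
  "nat \<Rightarrow> real \<Rightarrow> real \<Rightarrow> real \<Rightarrow> (nat \<Rightarrow> nat) \<Rightarrow> (nat \<Rightarrow> nat) \<Rightarrow> real" where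
  "pair_lyapunov N \<rho> \<theta> M x y = exp_moment N \<rho> x + exp_moment N \<rho> y
    + M * (1 - \<theta> ^ (total_jobs N x + total_jobs N y))"

lemma pair_lyapunov_commute: "pair_lyapunov N \<rho> \<theta> M x y = pair_lyapunov N \<rho> \<theta> M y x"
  by (simp add: pair_lyapunov_def add.commute)

lemma pair_lyapunov_generator:
  assumes "0 < \<theta>"
  shows "queue_generator N B l lam (\<lambda>z. pair_lyapunov N \<rho> \<theta> M z y) q
    = queue_generator N B l lam (exp_moment N \<rho>) q
      - M * \<theta> ^ (total_jobs N q + total_jobs N y) * (1 - \<theta>) *
        ((\<Sum>i\<in>{1..N}. service_rate N B l i q * of_bool (q i > 0)) / \<theta> - real N * lam)"
proof -
  have "(\<lambda>z. pair_lyapunov N \<rho> \<theta> M z y) = (\<lambda>z. 1 * exp_moment N \<rho> z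
      + (- M * \<theta> ^ total_jobs N y) * \<theta> ^ total_jobs N z + (exp_moment N \<rho> y + M))"
    by (simp add: pair_lyapunov_def power_add algebra_simps)
  then show ?thesis
    by (simp only: queue_generator_affine geometric_generator[OF assms]) (simp add: power_add)
qed

section \<open>Drift towards the empty state\<close>

locale subcritical_queues =
  fixes N :: nat and B lam :: real and l :: "real \<Rightarrow> real"
    and P :: "real \<Rightarrow> (nat \<Rightarrow> nat) \<Rightarrow> (nat \<Rightarrow> nat) pmf"
  assumes N_pos: "0 < N" and B_pos: "0 < B" and path_loss: "path_loss l"
    and lam_pos: "0 < lam" and subcritical: "lam < critical_rate N B l"
    and queue_semigroup: "queue_semigroup N B l lam P"
begin

abbreviation S where "S \<equiv> queue_states N"
abbreviation L where "L \<equiv> queue_generator N B l lam"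
abbreviation \<mu> where "\<mu> \<equiv> critical_rate N B l"

sublocale generated_semigroup S P L
  using queue_semigroup by unfold_locales (auto simp: queue_semigroup_def)

lemma critical_rate_le: "i \<in> {1..N} \<Longrightarrow> \<mu> \<le> service_rate N B l i q"
  using critical_rate_le_service_rate path_loss B_pos by simp

lemma generator_nonneg_at_min:
  assumes "\<And>x. x \<in> S \<Longrightarrow> 0 \<le> f x" "f q = 0" "q \<in> S"
  shows "0 \<le> L f q"
  using assms lam_pos subcritical
  by (intro queue_generator_nonneg_at_min) (auto intro: order_trans[OF _ critical_rate_le])

lemma exp_moment_drift_exists:
  obtains \<rho> c b where "1 < \<rho>" "0 < c" "0 \<le> b"
    "\<And>q. L (exp_moment N \<rho>) q \<le> - c * exp_moment N \<rho> q + b"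
proof -
  define \<rho> where "\<rho> = (1 + \<mu> / lam) / 2"
  define c where "c = (\<rho> - 1) * (\<mu> / \<rho> - lam)"
  have \<rho>: "1 < \<rho>" "\<rho> * lam < \<mu>"
    using lam_pos subcritical by (auto simp: \<rho>_def field_simps)
  then have "0 < c"
    unfolding c_def by (intro mult_pos_pos) (auto simp: field_simps)
  with \<rho> have "0 \<le> real N * ((\<rho> - 1) * lam + c)"
    using lam_pos by simp
  then show thesis
    by (rule that[OF \<rho>(1) \<open>0 < c\<close>]) (rule exp_moment_drift[OF lam_pos \<rho> critical_rate_le c_def])
qed

text \<open>Write \<open>v\<close> for the sum of the two exponential moments. If \<open>v\<close> exceeds \<open>4 * b / c\<close>, half of its own
  drift \<open>- c * v\<close> absorbs the constant \<open>2 * b\<close>. Otherwise there are at most \<open>n0\<close> jobs, and \<open>M\<close> is chosen so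
  large that the drift of the geometric term cancels \<open>2 * b\<close>. In both cases the drift is at most
  \<open>- c * v / 2\<close>, of which a small multiple of \<open>v + M\<close> is a part because \<open>v \<ge> 1\<close>.\<close>
lemma pair_drift_exists:
  assumes \<rho>: "1 < \<rho>" and c: "0 < c" and b: "0 \<le> b"
    and drift: "\<And>q. L (exp_moment N \<rho>) q \<le> - c * exp_moment N \<rho> q + b"
  obtains \<theta> M \<kappa> where "0 < \<theta>" "\<theta> < 1" "0 \<le> M" "0 < \<kappa>"
    "\<And>x y. \<lbrakk>x \<in> S; y \<in> S; (x, y) \<noteq> (\<lambda>_. 0, \<lambda>_. 0)\<rbrakk> \<Longrightarrow>
      L (\<lambda>z. pair_lyapunov N \<rho> \<theta> M z y) x + L (\<lambda>z. pair_lyapunov N \<rho> \<theta> M x z) y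
        < - \<kappa> * pair_lyapunov N \<rho> \<theta> M x y"
proof -
  have \<mu>: "0 < \<mu>"
    using lam_pos subcritical by simp
  (* A departure changes the geometric term by 1 / \<theta> times as much as an arrival. With this \<theta>,
     departures at total rate at least \<mu> outweigh arrivals at total rate 2 * N * lam by \<mu>. *)
  define \<theta> where "\<theta> = \<mu> / (2 * real N * lam + \<mu>)"
  define n0 where "n0 = nat \<lceil>(4 * b / c) / (\<rho> - 1)\<rceil>"
  define M where "M = 2 * b / ((1 - \<theta>) * \<mu> * \<theta> ^ n0)"
  define \<kappa> where "\<kappa> = c / (4 * (2 + M))"
  have \<theta>: "0 < \<theta>" "\<theta> < 1" and \<mu>\<theta>: "\<mu> / \<theta> - 2 * real N * lam = \<mu>"
    using \<mu> lam_pos N_pos by (auto simp: \<theta>_def add_pos_pos)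
  have M0: "0 \<le> M"
    using b \<theta> \<mu> by (simp add: M_def)
  have \<kappa>0: "0 < \<kappa>"
    using c M0 by (simp add: \<kappa>_def)
  show thesis
  proof (rule that[OF \<theta> M0 \<kappa>0])
    fix x y assume x: "x \<in> S" and y: "y \<in> S" and ne: "(x, y) \<noteq> (\<lambda>_. 0, \<lambda>_. 0)"
    let ?W = "pair_lyapunov N \<rho> \<theta> M"
    let ?n = "total_jobs N x + total_jobs N y"
    let ?v = "exp_moment N \<rho> x + exp_moment N \<rho> y"
    define s where "s q = (\<Sum>i\<in>{1..N}. service_rate N B l i q * of_bool (q i > 0))" for q
    have s0: "0 \<le> s q" for q
      unfolding s_def using \<mu> by (intro sum_nonneg mult_nonneg_nonneg) (auto intro: order_trans[OF _ critical_rate_le])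
    have s\<mu>: "\<mu> \<le> s q" if q: "q \<in> S" "q \<noteq> (\<lambda>_. 0)" for q
    proof -
      obtain i where i: "i \<in> {1..N}" "q i > 0"
        using q by (rule nonempty_queue_exists)
      have "service_rate N B l i q * of_bool (q i > 0) \<le> s q"
        unfolding s_def
        by (rule member_le_sum) (use i \<mu> in \<open>auto intro: order_trans[OF _ critical_rate_le]\<close>)
      with i critical_rate_le[of i q] show ?thesis by simp
    qed
    have "\<mu> \<le> s x + s y"
      using s\<mu>[OF x] s\<mu>[OF y] s0[of x] s0[of y] ne by fastforce
    then have "\<mu> / \<theta> \<le> (s x + s y) / \<theta>"
      using \<theta> by (intro divide_right_mono) auto
    then have rates: "\<mu> \<le> (s x / \<theta> - real N * lam) + (s y / \<theta> - real N * lam)"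
      using \<mu>\<theta> unfolding add_divide_distrib by linarith
    have Wx: "L (\<lambda>z. ?W z y) x
        = L (exp_moment N \<rho>) x - M * \<theta> ^ ?n * (1 - \<theta>) * (s x / \<theta> - real N * lam)"
      unfolding s_def by (rule pair_lyapunov_generator[OF \<theta>(1)])
    have Wy: "L (\<lambda>z. ?W x z) y
        = L (exp_moment N \<rho>) y - M * \<theta> ^ ?n * (1 - \<theta>) * (s y / \<theta> - real N * lam)"
      unfolding s_def pair_lyapunov_commute[of N \<rho> \<theta> M x] add.commute[of "total_jobs N x"]
      by (rule pair_lyapunov_generator[OF \<theta>(1)])
    have "M * \<theta> ^ ?n * (1 - \<theta>) * \<mu>
        \<le> M * \<theta> ^ ?n * (1 - \<theta>) * ((s x / \<theta> - real N * lam) + (s y / \<theta> - real N * lam))"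
      using rates M0 \<theta> by (intro mult_left_mono) auto
    then have total: "L (\<lambda>z. ?W z y) x + L (\<lambda>z. ?W x z) y
        \<le> - c * ?v + 2 * b - M * \<theta> ^ ?n * (1 - \<theta>) * \<mu>"
      unfolding Wx Wy using drift[of x] drift[of y] by (simp add: algebra_simps)
    have jobs: "real ?n * (\<rho> - 1) + 2 * real N \<le> ?v"
      using total_jobs_le_exp_moment[OF \<rho>, of N x] total_jobs_le_exp_moment[OF \<rho>, of N y]
      by (simp add: algebra_simps)
    then have v1: "1 \<le> ?v"
      using N_pos \<rho> mult_nonneg_nonneg[of "real ?n" "\<rho> - 1"] by linarith
    have half: "- c * ?v + 2 * b - M * \<theta> ^ ?n * (1 - \<theta>) * \<mu> \<le> - (c * ?v / 2)"
    proof (cases "?v \<le> 4 * b / c")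
      case True
      then have "real ?n * (\<rho> - 1) \<le> 4 * b / c"
        using jobs by linarith
      then have "real ?n \<le> (4 * b / c) / (\<rho> - 1)"
        using \<rho> by (subst pos_le_divide_eq) auto
      then have "?n \<le> n0"
        unfolding n0_def by linarith
      then have "\<theta> ^ n0 \<le> \<theta> ^ ?n"
        using \<theta> by (intro power_decreasing) auto
      then have "M * (1 - \<theta>) * \<mu> * \<theta> ^ n0 \<le> M * (1 - \<theta>) * \<mu> * \<theta> ^ ?n"
        using M0 \<theta> \<mu> by (intro mult_left_mono) auto
      moreover have "M * (1 - \<theta>) * \<mu> * \<theta> ^ n0 = 2 * b"
        using \<theta> \<mu> by (simp add: M_def)
      ultimately have "2 * b \<le> M * \<theta> ^ ?n * (1 - \<theta>) * \<mu>"
        by (simp add: mult_ac)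
      moreover have "0 \<le> c * ?v"
        using c v1 by simp
      ultimately show ?thesis by simp
    next
      case False
      then have "4 * b < c * ?v"
        using c by (simp add: field_simps)
      moreover have "0 \<le> M * \<theta> ^ ?n * (1 - \<theta>) * \<mu>"
        using M0 \<theta> \<mu> by simp
      ultimately show ?thesis by simp
    qed
    have "?W x y \<le> ?v + M"
      using M0 \<theta> by (simp add: pair_lyapunov_def mult_left_le)
    also have "\<dots> \<le> ?v + M * ?v"
      using M0 v1 mult_left_mono[of 1 ?v M] by simp
    also have "\<dots> \<le> (2 + M) * ?v"
      using v1 by (simp add: algebra_simps)
    finally have "\<kappa> * ?W x y \<le> \<kappa> * ((2 + M) * ?v)"
      using \<kappa>0 by (intro mult_left_mono) auto
    also have "\<dots> = (\<kappa> * (2 + M)) * ?v"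
      by simp
    also have "\<kappa> * (2 + M) = c / 4"
      using M0 by (simp add: \<kappa>_def field_simps)
    also have "c / 4 * ?v = c * ?v / 4"
      by simp
    also have "\<dots> < c * ?v / 2"
      using c v1 by simp
    finally show "L (\<lambda>z. ?W z y) x + L (\<lambda>z. ?W x z) y < - \<kappa> * ?W x y"
      using total half by simp
  qed
qed

section \<open>Comparison with the Lyapunov functions\<close>

text \<open>The truncation makes the test function bounded, so that the backward equation applies to it. The
  supersolution is the solution of \<open>v' = - c * v + (b + 1)\<close> started in the untruncated exponential moment; the
  surplus 1 over the drift constant \<open>b\<close> makes it strict, as continuous induction requires.\<close>
lemma truncated_moment_le:
  assumes \<rho>: "1 < \<rho>" and c: "0 < c" and b: "0 \<le> b"
    and drift: "\<And>q. L (exp_moment N \<rho>) q \<le> - c * exp_moment N \<rho> q + b"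
    and "x \<in> S" "0 \<le> T" "0 \<le> a"
  shows "evolve (\<lambda>q. min (exp_moment N \<rho> q) a) T x
    \<le> exp (- c * T) * exp_moment N \<rho> x + (b + 1) / c"
proof -
  let ?V = "exp_moment N \<rho>"
  let ?f = "\<lambda>q. min (?V q) a"
  let ?k = "(b + 1) / c"
  define h where "h t q = exp (- c * t) * (?V q - ?k) + ?k - evolve ?f t q" for t q
  define F where "F = {q \<in> S. ?V q \<le> a / exp (- c * T)}"
  have f: "\<bar>?f q\<bar> \<le> a" for q
    using exp_moment_nonneg[OF \<rho>, of N q] \<open>0 \<le> a\<close> by auto
  have k0: "0 \<le> ?k"
    using b c by simp
  have outside: "0 \<le> h t q" if "q \<in> S" "q \<notin> F" "0 \<le> t" "t \<le> T" for t q
  proof -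
    have "a < exp (- c * T) * ?V q"
      using that by (simp add: F_def field_simps not_le)
    also have "\<dots> \<le> exp (- c * t) * ?V q"
      using that c exp_moment_nonneg[OF \<rho>, of N q] by (intro mult_right_mono) auto
    finally have "a < exp (- c * t) * ?V q" .
    moreover have "evolve ?f t q \<le> a"
      using abs_expectation_le[where f="?f", OF f, of "P t q"] by simp
    moreover have "exp (- c * t) * ?k \<le> ?k"
      using k0 c that by (intro mult_left_le_one_le) auto
    ultimately show ?thesis
      by (simp add: h_def right_diff_distrib)
  qed
  have "0 \<le> h T x" if "x \<in> F"
  proof (rule nonneg_if_increasing_at_zeros[where F=F and h=h and T=T])
    show "finite F"
      unfolding F_def by (rule finite_exp_moment_le[OF \<rho>])
    show "continuous_on {0..} (\<lambda>t. h t p)" if "p \<in> F" for p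
      unfolding h_def
      by (intro continuous_intros continuous_on_evolve[where f="?f", OF f]) (use that in \<open>auto simp: F_def\<close>)
    show "0 \<le> h 0 p" if "p \<in> F" for p
      using that by (simp add: h_def evolve_0 F_def)
    fix t p assume p: "p \<in> F" and t: "0 \<le> t" "t < T"
      and nonneg: "\<And>q. q \<in> F \<Longrightarrow> 0 \<le> h t q" and zero: "h t p = 0"
    let ?e = "exp (- c * t)"
    let ?d = "- c * ?e * (?V p - ?k) - L (evolve ?f t) p"
    have pS: "p \<in> S"
      using p by (simp add: F_def)
    have "((\<lambda>s. (exp (- c * (t + s)) - ?e) / s * (?V p - ?k) - (evolve ?f (t + s) p - evolve ?f t p) / s)
        \<longlongrightarrow> ?d) (at_right 0)"
      by (intro tendsto_diff tendsto_mult tendsto_const exp_right_derivative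
          backward_equation[where f="?f", OF f pS t(1)])
    moreover have "(\<lambda>s. (h (t + s) p - h t p) / s) =
        (\<lambda>s. (exp (- c * (t + s)) - ?e) / s * (?V p - ?k) - (evolve ?f (t + s) p - evolve ?f t p) / s)"
      unfolding h_def by (rule ext) (simp add: diff_divide_distrib add_divide_distrib algebra_simps)
    moreover have "0 < ?d"
    proof -
      have "0 \<le> L (h t) p"
      proof (rule generator_nonneg_at_min[of "h t" p, OF _ zero pS])
        show "0 \<le> h t q" if "q \<in> S" for q
          using nonneg outside that t by (cases "q \<in> F") auto
      qed
      also have "h t = (\<lambda>q. ?e * ?V q + (- 1) * evolve ?f t q + (?k - ?e * ?k))"
        unfolding h_def by (rule ext) (simp add: algebra_simps)
      also have "L \<dots> p = ?e * L ?V p - L (evolve ?f t) p"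
        unfolding queue_generator_affine by simp
      also have "?e * L ?V p \<le> ?e * (- c * ?V p + b)"
        by (intro mult_left_mono drift) simp
      finally have "L (evolve ?f t) p \<le> ?e * (- c * ?V p + b)" by simp
      also have "\<dots> < ?e * (- c * ?V p + (b + 1))"
        by simp
      also have "\<dots> = - c * ?e * (?V p - ?k)"
        using c by (simp add: field_simps)
      finally show ?thesis by simp
    qed
    ultimately have "0 < ?d \<and> ((\<lambda>s. (h (t + s) p - h t p) / s) \<longlongrightarrow> ?d) (at_right 0)"
      by (simp only: simp_thms)
    then show "\<exists>d>0. ((\<lambda>s. (h (t + s) p - h t p) / s) \<longlongrightarrow> d) (at_right 0)"
      by blast
  qed (use that assms in auto)
  then have "0 \<le> h T x"
    using outside[of x T] assms by auto
  moreover have "0 \<le> exp (- c * T) * ?k"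
    by (intro mult_nonneg_nonneg k0) simp
  ultimately show ?thesis
    by (simp add: h_def right_diff_distrib)
qed

text \<open>The pair generator acts on the difference \<open>evolve f t x - evolve f t y\<close> one coordinate at a time, so
  it suffices to use the minimum property of the generator on the two slices of \<open>h\<close>
  through a zero. The empty pair has to be treated apart because the drift condition fails there, but there the difference is 0.\<close>
lemma pair_contraction:
  assumes f: "\<And>q. \<bar>f q\<bar> \<le> 1"
    and \<rho>: "1 < \<rho>" and \<theta>: "0 < \<theta>" "\<theta> < 1" and M: "0 \<le> M" and \<kappa>: "0 < \<kappa>"
    and drift: "\<And>x y. \<lbrakk>x \<in> S; y \<in> S; (x, y) \<noteq> (\<lambda>_. 0, \<lambda>_. 0)\<rbrakk> \<Longrightarrow>
      L (\<lambda>z. pair_lyapunov N \<rho> \<theta> M z y) x + L (\<lambda>z. pair_lyapunov N \<rho> \<theta> M x z) y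
        < - \<kappa> * pair_lyapunov N \<rho> \<theta> M x y"
    and "x \<in> S" "y \<in> S" "0 \<le> T"
  shows "evolve f T x - evolve f T y \<le> 2 * exp (- \<kappa> * T) * pair_lyapunov N \<rho> \<theta> M x y"
proof -
  let ?V = "exp_moment N \<rho>" and ?W = "pair_lyapunov N \<rho> \<theta> M"
  define h where "h t = (\<lambda>(x, y). 2 * exp (- \<kappa> * t) * ?W x y - (evolve f t x - evolve f t y))"
    for t
  define F where "F = {(x, y) \<in> S \<times> S. exp (- \<kappa> * T) * ?W x y \<le> 1 \<and> (x, y) \<noteq> (\<lambda>_. 0, \<lambda>_. 0)}"
  have W: "?V x + ?V y \<le> ?W x y" for x y
    using M \<theta> by (simp add: pair_lyapunov_def power_le_one)
  have V1: "1 \<le> ?V x" for x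
    using total_jobs_le_exp_moment[OF \<rho>, of N x] N_pos \<rho>
      mult_nonneg_nonneg[of "real (total_jobs N x)" "\<rho> - 1"] by linarith
  have W2: "2 \<le> ?W x y" for x y
    using W[of x y] V1[of x] V1[of y] by simp
  have u: "\<bar>evolve f t x - evolve f t y\<bar> \<le> 2" for t x y
    using abs_expectation_le[where f=f, OF f, of "P t x"] abs_expectation_le[where f=f, OF f, of "P t y"]
    by linarith
  have outside: "0 \<le> h t p" if "p \<in> S \<times> S" "p \<notin> F" "0 \<le> t" "t \<le> T" for t p
  proof -
    obtain x y where p: "p = (x, y)" by (cases p)
    show ?thesis
    proof (cases "p = (\<lambda>_. 0, \<lambda>_. 0)")
      case True
      then show ?thesis using W2[of x y] p by (simp add: h_def)
    next
      case False
      then have "1 \<le> exp (- \<kappa> * T) * ?W x y"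
        using that p by (auto simp: F_def)
      also have "\<dots> \<le> exp (- \<kappa> * t) * ?W x y"
        using that \<kappa> W2[of x y] by (intro mult_right_mono) auto
      finally show ?thesis
        using u[of t x y] by (simp add: h_def p)
    qed
  qed
  have "0 \<le> h T (x, y)" if "(x, y) \<in> F"
  proof (rule nonneg_if_increasing_at_zeros[where F=F and h=h and T=T])
    let ?G = "{q \<in> S. ?V q \<le> 1 / exp (- \<kappa> * T)}"
    have "F \<subseteq> ?G \<times> ?G"
    proof safe
      fix x y assume "(x, y) \<in> F"
      then have xy: "x \<in> S" "y \<in> S" "?W x y \<le> 1 / exp (- \<kappa> * T)"
        by (auto simp: F_def field_simps)
      then show "x \<in> S" "y \<in> S" by auto
      show "?V x \<le> 1 / exp (- \<kappa> * T)" "?V y \<le> 1 / exp (- \<kappa> * T)"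
        using W[of x y] V1[of x] V1[of y] xy(3) by linarith+
    qed
    then show "finite F"
      by (rule finite_subset) (intro finite_cartesian_product finite_exp_moment_le[OF \<rho>])
    show "continuous_on {0..} (\<lambda>t. h t p)" if "p \<in> F" for p
      using that unfolding h_def F_def
      by (auto intro!: continuous_intros continuous_on_evolve[where f=f, OF f])
    show "0 \<le> h 0 p" if "p \<in> F" for p
    proof -
      obtain x y where p: "p = (x, y)" by (cases p)
      show ?thesis using W2[of x y] u[of 0 x y] by (simp add: h_def p)
    qed
    fix t p assume p: "p \<in> F" and t: "0 \<le> t" "t < T"
      and nonneg: "\<And>q. q \<in> F \<Longrightarrow> 0 \<le> h t q" and zero: "h t p = 0"
    obtain x y where xy: "p = (x, y)" by (cases p)
    have x: "x \<in> S" and y: "y \<in> S" and ne: "(x, y) \<noteq> (\<lambda>_. 0, \<lambda>_. 0)"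
      using p by (auto simp: F_def xy)
    let ?e = "2 * exp (- \<kappa> * t)"
    let ?d = "2 * (- \<kappa> * exp (- \<kappa> * t)) * ?W x y - (L (evolve f t) x - L (evolve f t) y)"
    have "((\<lambda>s. 2 * ((exp (- \<kappa> * (t + s)) - exp (- \<kappa> * t)) / s) * ?W x y
          - ((evolve f (t + s) x - evolve f t x) / s - (evolve f (t + s) y - evolve f t y) / s))
        \<longlongrightarrow> ?d) (at_right 0)"
      by (intro tendsto_diff tendsto_mult tendsto_const exp_right_derivative
          backward_equation[where f=f, OF f _ t(1)] x y)
    moreover have "(\<lambda>s. (h (t + s) p - h t p) / s) =
        (\<lambda>s. 2 * ((exp (- \<kappa> * (t + s)) - exp (- \<kappa> * t)) / s) * ?W x y
          - ((evolve f (t + s) x - evolve f t x) / s - (evolve f (t + s) y - evolve f t y) / s))"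
      unfolding h_def xy
      by (rule ext) (simp add: diff_divide_distrib add_divide_distrib algebra_simps)
    moreover have "0 < ?d"
    proof -
      have all: "0 \<le> h t q" if "q \<in> S \<times> S" for q
        using nonneg outside that t by (cases "q \<in> F") auto
      have "0 \<le> L (\<lambda>z. h t (z, y)) x"
        by (rule generator_nonneg_at_min) (use all x y zero xy in auto)
      also have "(\<lambda>z. h t (z, y)) = (\<lambda>z. ?e * ?W z y + (- 1) * evolve f t z + evolve f t y)"
        unfolding h_def by (rule ext) simp
      also have "L \<dots> x = ?e * L (\<lambda>z. ?W z y) x - L (evolve f t) x"
        unfolding queue_generator_affine by simp
      finally have 1: "L (evolve f t) x \<le> ?e * L (\<lambda>z. ?W z y) x" by simp
      have "0 \<le> L (\<lambda>z. h t (x, z)) y"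
        by (rule generator_nonneg_at_min) (use all x y zero xy in auto)
      also have "(\<lambda>z. h t (x, z)) = (\<lambda>z. ?e * ?W x z + 1 * evolve f t z + (- evolve f t x))"
        unfolding h_def by (rule ext) simp
      also have "L \<dots> y = ?e * L (\<lambda>z. ?W x z) y + L (evolve f t) y"
        unfolding queue_generator_affine by simp
      finally have 2: "0 \<le> ?e * L (\<lambda>z. ?W x z) y + L (evolve f t) y" .
      have "?e * (L (\<lambda>z. ?W z y) x + L (\<lambda>z. ?W x z) y) < ?e * (- \<kappa> * ?W x y)"
        by (rule mult_strict_left_mono[OF drift[OF x y ne]]) simp
      with 1 2 show ?thesis
        by (simp add: algebra_simps)
    qed
    ultimately have "0 < ?d \<and> ((\<lambda>s. (h (t + s) p - h t p) / s) \<longlongrightarrow> ?d) (at_right 0)"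
      by (simp only: simp_thms)
    then show "\<exists>d>0. ((\<lambda>s. (h (t + s) p - h t p) / s) \<longlongrightarrow> d) (at_right 0)"
      by blast
  qed (use that assms in auto)
  then have "0 \<le> h T (x, y)"
    using outside[of "(x, y)" T] assms by auto
  then show ?thesis
    by (simp add: h_def)
qed

section \<open>Exponential ergodicity\<close>

text \<open>By invariance, a truncated moment under \<open>\<pi>\<close> does not change under the evolution, whereas the evolved one is
  bounded by \<open>exp (- c * t) * V + (b + 1) / c\<close>, again truncated. Letting first the time and then the truncation
  level tend to infinity bounds the moment itself by \<open>(b + 1) / c\<close>. The truncation on the right-hand side
  is what allows dominated convergence before integrability is known.\<close>
lemma integrable_exp_moment_invariant:
  assumes \<rho>: "1 < \<rho>" and c: "0 < c" and b: "0 \<le> b"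
    and drift: "\<And>q. L (exp_moment N \<rho>) q \<le> - c * exp_moment N \<rho> q + b"
    and inv: "invariant_distribution_on S P \<pi>"
  shows "integrable (measure_pmf \<pi>) (exp_moment N \<rho>)"
proof -
  let ?V = "exp_moment N \<rho>"
  let ?k = "(b + 1) / c"
  let ?f = "\<lambda>a q. min (?V q) (real a)"
  have k0: "0 \<le> ?k"
    using b c by simp
  have V0: "0 \<le> ?V q" for q
    by (rule exp_moment_nonneg[OF \<rho>])
  have f: "\<bar>?f a q\<bar> \<le> real a" for a q
    using V0[of q] by simp
  have int_f: "integrable (measure_pmf \<pi>) (?f a)" for a
    by (rule integrable_measure_pmf_bounded[where f="?f a", OF f])
  have AE_S: "AE y in measure_pmf \<pi>. y \<in> S"
    using inv by (auto simp: invariant_distribution_on_def AE_measure_pmf_iff)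
  have bound: "measure_pmf.expectation \<pi> (?f a) \<le> ?k" for a
  proof -
    define g where "g m q = min (exp (- c * real m) * ?V q + ?k) (real a)" for m q
    have g: "\<bar>g m q\<bar> \<le> real a" for m q
      using V0[of q] k0 by (simp add: g_def)
    have "measure_pmf.expectation \<pi> (?f a) \<le> measure_pmf.expectation \<pi> (g m)" for m
    proof -
      have "measure_pmf.expectation \<pi> (?f a) = measure_pmf.expectation (bind_pmf \<pi> (P m)) (?f a)"
        using inv by (simp add: invariant_distribution_on_def)
      also have "\<dots> = measure_pmf.expectation \<pi> (evolve (?f a) m)"
        by (rule expectation_bind_pmf[where f="?f a", OF f])
      also have "\<dots> \<le> measure_pmf.expectation \<pi> (g m)"
      proof (rule integral_mono_AE)
        have u: "\<bar>evolve (?f a) m q\<bar> \<le> real a" for q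
          by (rule abs_expectation_le[where f="?f a", OF f])
        show "integrable (measure_pmf \<pi>) (evolve (?f a) m)"
          by (rule integrable_measure_pmf_bounded[OF u])
        show "integrable (measure_pmf \<pi>) (g m)"
          by (rule integrable_measure_pmf_bounded[where f="g m", OF g])
        show "AE q in measure_pmf \<pi>. evolve (?f a) m q \<le> g m q"
          using AE_S
        proof eventually_elim
          case (elim q)
          then show ?case
            using truncated_moment_le[OF \<rho> c b drift elim, of "real m" "real a"] u[of q]
            by (simp add: g_def)
        qed
      qed
      finally show ?thesis .
    qed
    moreover have "(\<lambda>m. measure_pmf.expectation \<pi> (g m))
        \<longlonglongrightarrow> measure_pmf.expectation \<pi> (\<lambda>_. min ?k (real a))"
    proof (rule integral_dominated_convergence[where w="\<lambda>_. real a"])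
      have "(\<lambda>m. exp (- c) ^ m) \<longlonglongrightarrow> 0"
        by (rule LIMSEQ_power_zero) (use c in simp)
      then have "(\<lambda>m. exp (- c * real m)) \<longlonglongrightarrow> 0"
        by (simp add: exp_of_nat_mult[symmetric] mult.commute)
      then have "(\<lambda>m. g m q) \<longlonglongrightarrow> min (0 * ?V q + ?k) (real a)" for q
        unfolding g_def by (intro tendsto_intros)
      then show "AE q in measure_pmf \<pi>. (\<lambda>m. g m q) \<longlonglongrightarrow> min ?k (real a)"
        by simp
    qed (use g in auto)
    ultimately have "measure_pmf.expectation \<pi> (?f a) \<le> measure_pmf.expectation \<pi> (\<lambda>_. min ?k (real a))"
      by (intro LIMSEQ_le_const) auto
    also have "\<dots> \<le> ?k"
      by simp
    finally show ?thesis .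
  qed
  have "incseq (\<lambda>a. measure_pmf.expectation \<pi> (?f a))"
    by (intro incseq_SucI integral_mono int_f) auto
  then obtain I where lim: "(\<lambda>a. measure_pmf.expectation \<pi> (?f a)) \<longlonglongrightarrow> I"
    using incseq_convergent bound by (metis (no_types, lifting))
  have "(\<lambda>a. ?f a q) \<longlonglongrightarrow> ?V q" for q
  proof (rule tendsto_eventually)
    have "\<forall>\<^sub>F a in sequentially. ?V q \<le> real a"
      using filterlim_real_sequentially by (simp add: filterlim_at_top)
    then show "\<forall>\<^sub>F a in sequentially. ?f a q = ?V q"
      by eventually_elim simp
  qed
  then show ?thesis
    by (intro integral_monotone_convergence_nonneg(1)[OF int_f _ _ _ lim])
       (use V0 in \<open>auto simp: mono_def min_def\<close>)
qed

text \<open>The rate comes from the pair drift and so works for all initial states at once; the constant grows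
  with the exponential moment at the initial state.\<close>
theorem exponential_ergodicity:
  assumes inv: "invariant_distribution_on S P \<pi>"
  shows "\<exists>\<kappa>>0. \<forall>x\<in>S. \<exists>C. \<forall>t\<ge>0. tv_norm_diff (P t x) \<pi> \<le> C * exp (- \<kappa> * t)"
proof -
  obtain \<rho> c b where \<rho>: "1 < \<rho>" and c: "0 < c" "0 \<le> b"
    and drift: "\<And>q. L (exp_moment N \<rho>) q \<le> - c * exp_moment N \<rho> q + b"
    using exp_moment_drift_exists by blast
  obtain \<theta> M \<kappa> where \<theta>: "0 < \<theta>" "\<theta> < 1" and M: "0 \<le> M" and \<kappa>: "0 < \<kappa>"
    and pair_drift: "\<And>x y. \<lbrakk>x \<in> S; y \<in> S; (x, y) \<noteq> (\<lambda>_. 0, \<lambda>_. 0)\<rbrakk> \<Longrightarrow>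
      L (\<lambda>z. pair_lyapunov N \<rho> \<theta> M z y) x + L (\<lambda>z. pair_lyapunov N \<rho> \<theta> M x z) y
        < - \<kappa> * pair_lyapunov N \<rho> \<theta> M x y"
    using pair_drift_exists[OF \<rho> c drift] by blast
  let ?V = "exp_moment N \<rho>"
  have intV: "integrable (measure_pmf \<pi>) ?V"
    by (rule integrable_exp_moment_invariant[OF \<rho> c drift inv])
  have AE_S: "AE y in measure_pmf \<pi>. y \<in> S"
    using inv by (auto simp: invariant_distribution_on_def AE_measure_pmf_iff)
  have "tv_norm_diff (P t x) \<pi> \<le> 2 * (?V x + M + measure_pmf.expectation \<pi> ?V) * exp (- \<kappa> * t)"
    if x: "x \<in> S" and t: "0 \<le> t" for x t
    unfolding tv_norm_diff_def
  proof (rule cSUP_least)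
    show "{f :: (nat \<Rightarrow> nat) \<Rightarrow> real. \<forall>x. \<bar>f x\<bar> \<le> 1} \<noteq> {}"
      by (auto intro!: exI[of _ "\<lambda>_. 0"])
    fix f :: "(nat \<Rightarrow> nat) \<Rightarrow> real"
    assume "f \<in> {f. \<forall>x. \<bar>f x\<bar> \<le> 1}"
    then have f: "\<bar>f y\<bar> \<le> 1" for y by simp
    let ?W = "\<lambda>y. 2 * exp (- \<kappa> * t) * (?V x + ?V y + M)"
    have le: "pair_lyapunov N \<rho> \<theta> M p q \<le> ?V p + ?V q + M" for p q
      using M \<theta> by (simp add: pair_lyapunov_def mult_left_le)
    have contr: "evolve f t p - evolve f t q \<le> 2 * exp (- \<kappa> * t) * (?V p + ?V q + M)"
      if "p \<in> S" "q \<in> S" for p q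
    proof -
      have "evolve f t p - evolve f t q \<le> 2 * exp (- \<kappa> * t) * pair_lyapunov N \<rho> \<theta> M p q"
        by (rule pair_contraction[where f=f, OF f \<rho> \<theta> M \<kappa> pair_drift that t])
      also have "\<dots> \<le> 2 * exp (- \<kappa> * t) * (?V p + ?V q + M)"
        by (intro mult_left_mono le) simp
      finally show ?thesis .
    qed
    have int_u: "integrable (measure_pmf \<pi>) (evolve f t)"
      by (rule integrable_measure_pmf_bounded[where c=1])
         (rule abs_expectation_le[where f=f, OF f])
    have "measure_pmf.expectation \<pi> f = measure_pmf.expectation (bind_pmf \<pi> (P t)) f"
      using inv t by (simp add: invariant_distribution_on_def)
    also have "\<dots> = measure_pmf.expectation \<pi> (evolve f t)"
      by (rule expectation_bind_pmf[where f=f, OF f])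
    finally have "evolve f t x - measure_pmf.expectation \<pi> f
        = measure_pmf.expectation \<pi> (\<lambda>y. evolve f t x - evolve f t y)"
      using int_u by simp
    also have "\<bar>\<dots>\<bar> \<le> measure_pmf.expectation \<pi> (\<lambda>y. \<bar>evolve f t x - evolve f t y\<bar>)"
      by (rule integral_abs_bound)
    also have "\<dots> \<le> measure_pmf.expectation \<pi> ?W"
    proof (rule integral_mono_AE)
      show "AE y in measure_pmf \<pi>. \<bar>evolve f t x - evolve f t y\<bar> \<le> ?W y"
        using AE_S
      proof eventually_elim
        case (elim y)
        then show ?case
          using contr[OF x elim] contr[OF elim x] by (simp add: abs_le_iff algebra_simps)
      qed
    qed (use int_u intV in auto)
    also have "\<dots> = 2 * (?V x + M + measure_pmf.expectation \<pi> ?V) * exp (- \<kappa> * t)"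
      using intV by (simp add: algebra_simps)
    finally show "\<bar>measure_pmf.expectation (P t x) f - measure_pmf.expectation \<pi> f\<bar>
        \<le> 2 * (?V x + M + measure_pmf.expectation \<pi> ?V) * exp (- \<kappa> * t)" .
  qed
  with \<kappa> show ?thesis by blast
qed

end

theorem theorem3p28:
  fixes N :: nat and B lam :: real and l :: "real \<Rightarrow> real"
    and P :: "real \<Rightarrow> (nat \<Rightarrow> nat) \<Rightarrow> (nat \<Rightarrow> nat) pmf"
    and \<pi> :: "(nat \<Rightarrow> nat) pmf"
  assumes "N \<ge> 2" and "B > 0" and "path_loss l"
    and "0 < lam" and "lam < critical_rate N B l"
    and "queue_semigroup N B l lam P"
    and "invariant_distribution_on (queue_states N) P \<pi>"
  shows "\<forall>x\<in>queue_states N. \<exists>C \<kappa>. \<kappa> > 0 \<and>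
           (\<forall>t\<ge>0. tv_norm_diff (P t x) \<pi> \<le> C * exp (- \<kappa> * t))"
proof -
  interpret subcritical_queues N B lam l P
    using assms by unfold_locales auto
  show ?thesis
    using exponential_ergodicity[OF assms(7)] by blast
qed

end
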